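(* Let $\Gamma$ be an infinite set and let $M=\Gamma\cup\{0\}\cup\{z\}$ (with $0,z\notin\Gamma$ and $0\ne z$) be the metric space, with designated origin $0$, whose distance is given by $d(x,x)=0$, $d(z,0)=d(0,z)=2$, and $d(x,y)=1$ for all other pairs $x\neq y$. Let $X$ be a Banach space, let $y\in S_X$, and for $\alpha>0$ put $$S_\alpha:=\{f\in B_{Lip(M,X^* )}: f(z)(y)>2-\alpha\}.$$ If $y$ is a point of Fréchet differentiability of $B_X$, then $\inf_{\alpha>0}\operatorname{diam}(S_\alpha)=0$.
   Context: All Banach spaces are real; $B_X$ and $S_X$ denote the closed unit ball and unit sphere of $X$. $Lip(M,X^* )$ is the Banach space of all Lipschitz functions $f:M\to X^*$ with $f(0)=0$, with norm $\|f\|=\sup\{\|f(u)-f(v)\|/d(u,v): u\neq v\in M\}$; diameters are taken with respect to this norm. (The set $S_\alpha$ is the weak-star slice $S(B_{Lip(M,X^* )},\varphi,\alpha/2)=\{f\in B_{Lip(M,X^* )}:\varphi(f)>1-\alpha/2\}$ given by the norm-one functional $\varphi=\tfrac12\delta_{z,y}$, where $\delta_{z,y}(f)=f(z)(y)$.) A point $x\in X$ is a point of Fréchet differentiability if the limit $\lim_{t\to0}\frac{\|x+th\|-\|x\|}{t}$ exists uniformly for $h\in S_X$ and defines a continuous linear functional of $h\in X$. *)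

theory Defs
  imports "HOL-Analysis.Analysis"
begin

definition Lip :: "'m metric \<Rightarrow> 'm \<Rightarrow> ('m \<Rightarrow> 'b::real_normed_vector) set" where
  "Lip M orig = {f \<in> extensional (mspace M).
     Lipschitz_continuous_map M euclidean_metric f \<and> f orig = 0}"

(* The supremum is meaningful only if M has at least two points. *)
definition Lip_norm :: "'m metric \<Rightarrow> ('m \<Rightarrow> 'b::real_normed_vector) \<Rightarrow> real" where
  "Lip_norm M f =
     (SUP (u, v)\<in>{(u, v). u \<in> mspace M \<and> v \<in> mspace M \<and> u \<noteq> v}.
        norm (f u - f v) / mdist M u v)"

definition Lip_ball :: "'m metric \<Rightarrow> 'm \<Rightarrow> ('m \<Rightarrow> 'b::real_normed_vector) set" where
  "Lip_ball M orig = {f \<in> Lip M orig. Lip_norm M f \<le> 1}"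

(* Analogue of the library's diameter for the distance induced by Lip_norm. The pointwise
   difference is not restricted to mspace M again, but Lip_norm only sees its values there. *)
definition Lip_diameter :: "'m metric \<Rightarrow> ('m \<Rightarrow> 'b::real_normed_vector) set \<Rightarrow> real" where
  "Lip_diameter M S =
     (if S = {} then 0 else SUP (f, g)\<in>S \<times> S. Lip_norm M (\<lambda>u. f u - g u))"

definition frechet_differentiability_point :: "'x::real_normed_vector \<Rightarrow> bool" where
  "frechet_differentiability_point x \<longleftrightarrow>
     (\<exists>D :: 'x \<Rightarrow>\<^sub>L real.
        (\<forall>h. ((\<lambda>t. (norm (x + t *\<^sub>R h) - norm x) / t) \<longlongrightarrow> blinfun_apply D h) (at 0)) \<and>
        uniform_limit (sphere 0 1) (\<lambda>t h. (norm (x + t *\<^sub>R h) - norm x) / t)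
          (blinfun_apply D) (at (0::real)))"

definition Gamma_dist :: "'a \<Rightarrow> 'a \<Rightarrow> 'a \<Rightarrow> 'a \<Rightarrow> real" where
  "Gamma_dist orig z u v = (if u = v then 0 else if {u, v} = {z, orig} then 2 else 1)"

definition Gamma_space :: "'a set \<Rightarrow> 'a \<Rightarrow> 'a \<Rightarrow> 'a metric" where
  "Gamma_space \<Gamma> orig z = metric (\<Gamma> \<union> {orig} \<union> {z}, Gamma_dist orig z)"

lemma Metric_space_Gamma: "Metric_space (\<Gamma> \<union> {orig} \<union> {z}) (Gamma_dist orig z)"
  by unfold_locales (auto simp: Gamma_dist_def doubleton_eq_iff split: if_splits)

lemma mspace_Gamma_space [simp]: "mspace (Gamma_space \<Gamma> orig z) = \<Gamma> \<union> {orig} \<union> {z}"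
  unfolding Gamma_space_def by (rule Metric_space.mspace_metric[OF Metric_space_Gamma])

lemma mdist_Gamma_space [simp]: "mdist (Gamma_space \<Gamma> orig z) = Gamma_dist orig z"
  unfolding Gamma_space_def by (rule Metric_space.mdist_metric[OF Metric_space_Gamma])

definition Gamma_slice ::
  "'a set \<Rightarrow> 'a \<Rightarrow> 'a \<Rightarrow> 'x::real_normed_vector \<Rightarrow> real \<Rightarrow> ('a \<Rightarrow> ('x \<Rightarrow>\<^sub>L real)) set" where
  "Gamma_slice \<Gamma> orig z y \<alpha> =
     {f \<in> Lip_ball (Gamma_space \<Gamma> orig z) orig. blinfun_apply (f z) y > 2 - \<alpha>}"

end

theory Submission
  imports Defs
begin

text \<open>
  For \<open>f\<close> in the slice and \<open>x \<in> \<Gamma>\<close>, the bound \<open>\<parallel>f z - f x\<parallel> \<le> 1\<close> forces \<open>f x y > 1 - \<alpha>\<close>, so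
  \<open>f x\<close> and \<open>f z / 2\<close> both lie in the slice of the dual unit ball determined by \<open>y\<close> and \<open>\<alpha>\<close>.
  By Smulian's argument, Frechet differentiability of the norm at \<open>y\<close> makes these slices shrink
  to the derivative \<open>D\<close>. Hence \<open>f\<close> is uniformly close to the function that is \<open>0\<close> at the origin,
  \<open>D\<close> on \<open>\<Gamma>\<close> and \<open>2 D\<close> at \<open>z\<close>. As distinct points have distance at least \<open>1\<close>, this is
  closeness in the Lipschitz norm.
\<close>

text \<open>The extra pair \<open>u\<close>, \<open>v\<close> keeps the supremum off the empty set,
  where its value carries no information.\<close>

lemma Lip_norm_leI:
  assumes "u \<in> mspace M" "v \<in> mspace M" "u \<noteq> v"
    and "\<And>u v. u \<in> mspace M \<Longrightarrow> v \<in> mspace M \<Longrightarrow> u \<noteq> v \<Longrightarrow> norm (f u - f v) \<le> C * mdist M u v"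
  shows "Lip_norm M f \<le> C"
  unfolding Lip_norm_def
proof (rule cSUP_least)
  show "{(u, v). u \<in> mspace M \<and> v \<in> mspace M \<and> u \<noteq> v} \<noteq> {}"
    using assms(1-3) by blast
next
  fix p
  assume "p \<in> {(u, v). u \<in> mspace M \<and> v \<in> mspace M \<and> u \<noteq> v}"
  then obtain u v where p: "p = (u, v)" "u \<in> mspace M" "v \<in> mspace M" "u \<noteq> v"
    by auto
  then have "0 < mdist M u v"
    by (metis mdist_nonneg mdist_zero less_eq_real_def)
  with p assms(4)[of u v] show "(case p of (u, v) \<Rightarrow> norm (f u - f v) / mdist M u v) \<le> C"
    by (simp add: divide_le_eq)
qed

lemma Lip_ball_dist_le:
  assumes f: "f \<in> Lip_ball M orig" and u: "u \<in> mspace M" and v: "v \<in> mspace M"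
  shows "norm (f u - f v) \<le> mdist M u v"
proof (cases "u = v")
  case True
  with u show ?thesis by simp
next
  case False
  let ?P = "{(u, v). u \<in> mspace M \<and> v \<in> mspace M \<and> u \<noteq> v}"
  let ?q = "\<lambda>(u, v). norm (f u - f v) / mdist M u v"
  have pos: "0 < mdist M a b" if "a \<in> mspace M" "b \<in> mspace M" "a \<noteq> b" for a b
    using that by (metis mdist_nonneg mdist_zero less_eq_real_def)
  \<comment> \<open>A real supremum dominates its members only when they are bounded above.
    \<open>Lip_norm M f \<le> 1\<close> alone does not give this, so a Lipschitz constant
    \<open>B\<close> from membership in \<open>Lip\<close> supplies it.\<close>
  obtain B where B: "norm (f a - f b) \<le> B * mdist M a b"
    if "a \<in> mspace M" "b \<in> mspace M" for a b
    using f unfolding Lip_ball_def Lip_def Lipschitz_continuous_map_def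
    by (auto simp: dist_norm)
  have "bdd_above (?q ` ?P)"
    by (rule bdd_aboveI[of _ B]) (auto simp: divide_le_eq pos B)
  then have "?q (u, v) \<le> Lip_norm M f"
    unfolding Lip_norm_def by (rule cSUP_upper2[where x = "(u, v)"]) (use u v False in auto)
  also have "\<dots> \<le> 1"
    using f by (simp add: Lip_ball_def)
  finally show ?thesis
    using pos[OF u v False] by (simp add: divide_le_eq)
qed

lemma Lip_diameter_leI:
  assumes "0 \<le> C" and "\<And>f g. f \<in> S \<Longrightarrow> g \<in> S \<Longrightarrow> Lip_norm M (\<lambda>u. f u - g u) \<le> C"
  shows "Lip_diameter M S \<le> C"
proof (cases "S = {}")
  case True
  with assms show ?thesis by (simp add: Lip_diameter_def)
next
  case False
  then have "(SUP (f, g)\<in>S \<times> S. Lip_norm M (\<lambda>u. f u - g u)) \<le> C"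
    by (intro cSUP_least) (use assms(2) in auto)
  with False show ?thesis by (simp add: Lip_diameter_def)
qed

text \<open>The diagonal pair \<open>(f, f)\<close> contributes the value 0. For the supremum to
  dominate it, the distances must be bounded above, and inside the unit ball 2 is a bound.\<close>

lemma Lip_diameter_nonneg:
  assumes "u \<in> mspace M" "v \<in> mspace M" "u \<noteq> v" and S: "S \<subseteq> Lip_ball M orig"
  shows "0 \<le> Lip_diameter M S"
proof (cases "S = {}")
  case True
  then show ?thesis by (simp add: Lip_diameter_def)
next
  case False
  then obtain f where f: "f \<in> S" by blast
  let ?d = "\<lambda>(f, g). Lip_norm M (\<lambda>u. f u - g u)"
  have le2: "Lip_norm M (\<lambda>u. g u - h u) \<le> 2" if "g \<in> S" "h \<in> S" for g h
  proof (rule Lip_norm_leI[OF assms(1-3)])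
    fix a b assume "a \<in> mspace M" "b \<in> mspace M"
    then have "norm (g a - g b) \<le> mdist M a b" "norm (h a - h b) \<le> mdist M a b"
      using that S by (auto intro: Lip_ball_dist_le)
    moreover have "norm ((g a - g b) - (h a - h b)) \<le> norm (g a - g b) + norm (h a - h b)"
      by (rule norm_triangle_ineq4)
    ultimately show "norm (g a - h a - (g b - h b)) \<le> 2 * mdist M a b"
      by (simp add: algebra_simps)
  qed
  then have "bdd_above (?d ` (S \<times> S))"
    by (intro bdd_aboveI[of _ 2]) auto
  then have "?d (f, f) \<le> (SUP p\<in>S \<times> S. ?d p)"
    by (rule cSUP_upper2[where x = "(f, f)"]) (use f in auto)
  moreover have "?d (f, f) = 0"
  proof -
    \<comment> \<open>Even the zero function has \<open>Lip_norm\<close> 0 only because this index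
      set is nonempty.\<close>
    have "{(u, v). u \<in> mspace M \<and> v \<in> mspace M \<and> u \<noteq> v} \<noteq> {}"
      using assms(1-3) by blast
    then show ?thesis by (simp add: Lip_norm_def case_prod_unfold)
  qed
  ultimately show ?thesis
    using False by (simp add: Lip_diameter_def)
qed

text \<open>The sphere is symmetric, so a one-sided bound at h and -h bounds the absolute value, and
  homogeneity does the rest. If the space is trivial, the sphere is empty and only
  \<open>0 \<le> C\<close> speaks.\<close>

lemma norm_blinfun_le_sphere:
  fixes p :: "'x::real_normed_vector \<Rightarrow>\<^sub>L real"
  assumes "0 \<le> C" and "\<And>h. norm h = 1 \<Longrightarrow> blinfun_apply p h \<le> C"
  shows "norm p \<le> C"
proof (rule norm_blinfun_bound)
  fix x
  show "norm (blinfun_apply p x) \<le> C * norm x"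
  proof (cases "x = 0")
    case True
    then show ?thesis by (simp add: blinfun.zero_right)
  next
    case False
    then have "blinfun_apply p (x /\<^sub>R norm x) \<le> C" "blinfun_apply p (- (x /\<^sub>R norm x)) \<le> C"
      by (auto intro!: assms(2) simp del: scaleR_minus_left)
    with False show ?thesis
      by (simp add: blinfun.scaleR_right blinfun.minus_right divide_simps abs_le_iff)
  qed
qed (fact assms(1))

text \<open>One half of Smulian's test. Since p is at most the norm, p(y + th) is at most |y| + t(D
  h + e/2), up to first order uniformly in h. If p almost attains |y| at y, subtracting p(y) and
  dividing by t leaves p(h) < D h + e.\<close>

lemma frechet_smulian:
  fixes y :: "'x::real_normed_vector"
  assumes "frechet_differentiability_point y"
  obtains D :: "'x \<Rightarrow>\<^sub>L real" where
    "\<And>e. 0 < e \<Longrightarrow> \<exists>\<alpha>>0. \<forall>p :: 'x \<Rightarrow>\<^sub>L real. norm p \<le> 1 \<longrightarrow> norm y - \<alpha> < blinfun_apply p y \<longrightarrow> norm (p - D) \<le> e"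
proof -
  obtain D :: "'x \<Rightarrow>\<^sub>L real" where
    D: "uniform_limit (sphere 0 1) (\<lambda>t h. (norm (y + t *\<^sub>R h) - norm y) / t) (blinfun_apply D) (at (0::real))"
    using assms unfolding frechet_differentiability_point_def by blast
  show thesis
  proof (rule that)
    fix e :: real assume e: "0 < e"
    from D e have "\<forall>\<^sub>F t in at (0::real). \<forall>h\<in>sphere 0 1.
        dist ((norm (y + t *\<^sub>R h) - norm y) / t) (blinfun_apply D h) < e / 2"
      unfolding uniform_limit_iff using half_gt_zero by blast
    then obtain r where r: "0 < r" "\<And>t h. t \<noteq> 0 \<Longrightarrow> \<bar>t\<bar> < r \<Longrightarrow> norm h = 1 \<Longrightarrow>
        \<bar>(norm (y + t *\<^sub>R h) - norm y) / t - blinfun_apply D h\<bar> < e / 2"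
      unfolding eventually_at by (auto simp: dist_real_def)
    \<comment> \<open>By uniformity a single positive t serves all unit vectors h, so the slice
      width below does not depend on h.\<close>
    define t where "t = r / 2"
    have t: "0 < t" "\<bar>t\<bar> < r"
      using r(1) by (auto simp: t_def)
    \<comment> \<open>The width \<open>t * (e / 2)\<close> adds to the differentiation error, also
      \<open>t * (e / 2)\<close>, to give \<open>t * e\<close>.\<close>
    have "norm (p - D) \<le> e" if p: "norm p \<le> 1" "norm y - t * (e / 2) < blinfun_apply p y" for p :: "'x \<Rightarrow>\<^sub>L real"
    proof (rule norm_blinfun_le_sphere)
      fix h :: 'x assume h: "norm h = 1"
      have "\<bar>(norm (y + t *\<^sub>R h) - norm y) / t - blinfun_apply D h\<bar> < e / 2"
        using r(2) t h by simp
      then have "(norm (y + t *\<^sub>R h) - norm y) / t < blinfun_apply D h + e / 2"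
        by linarith
      then have "norm (y + t *\<^sub>R h) < norm y + t * (blinfun_apply D h + e / 2)"
        using t(1) by (simp add: field_simps)
      moreover have "blinfun_apply p (y + t *\<^sub>R h) \<le> norm (y + t *\<^sub>R h)"
        using norm_blinfun[of p "y + t *\<^sub>R h"] mult_right_mono[OF p(1), of "norm (y + t *\<^sub>R h)"]
        by simp
      ultimately have "t * blinfun_apply p h < t * (blinfun_apply D h + e)"
        using p(2) by (simp add: blinfun.add_right blinfun.scaleR_right algebra_simps)
      with t(1) show "blinfun_apply (p - D) h \<le> e"
        by (simp add: blinfun.diff_left)
    qed (use e in simp)
    then show "\<exists>\<alpha>>0. \<forall>p :: 'x \<Rightarrow>\<^sub>L real. norm p \<le> 1 \<longrightarrow> norm y - \<alpha> < blinfun_apply p y \<longrightarrow> norm (p - D) \<le> e"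
      using t(1) e by (intro exI[of _ "t * (e / 2)"]) auto
  qed
qed

lemma Gamma_slice_near:
  fixes D :: "'x::real_normed_vector \<Rightarrow>\<^sub>L real"
  assumes f: "f \<in> Gamma_slice \<Gamma> orig z y \<alpha>"
    and pts: "orig \<notin> \<Gamma>" "z \<notin> \<Gamma>" "orig \<noteq> z" and y: "norm y = 1" and \<alpha>: "0 < \<alpha>"
    and near: "\<And>p :: 'x \<Rightarrow>\<^sub>L real. norm p \<le> 1 \<Longrightarrow> norm y - \<alpha> < blinfun_apply p y \<Longrightarrow> norm (p - D) \<le> e"
    and u: "u \<in> \<Gamma> \<union> {orig} \<union> {z}"
  shows "norm (f u - (if u = orig then 0 else if u = z then 2 *\<^sub>R D else D)) \<le> 2 * e"
proof -
  have fz: "2 - \<alpha> < blinfun_apply (f z) y" and f0: "f orig = 0"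
    and lip: "\<And>u v. u \<in> \<Gamma> \<union> {orig} \<union> {z} \<Longrightarrow> v \<in> \<Gamma> \<union> {orig} \<union> {z} \<Longrightarrow>
      norm (f u - f v) \<le> Gamma_dist orig z u v"
    using f Lip_ball_dist_le[of f "Gamma_space \<Gamma> orig z" orig]
    by (auto simp: Gamma_slice_def Lip_ball_def Lip_def)
  have z: "norm (f z - 2 *\<^sub>R D) \<le> 2 * e"
  proof -
    have "norm (f z) \<le> 2"
      using lip[of z orig] pts f0 by (simp add: Gamma_dist_def)
    \<comment> \<open>Halving brings \<open>f z\<close> into the dual unit ball, with value at y
      above 1 - \<alpha>/2, hence above 1 - \<alpha>.\<close>
    then have "norm ((1/2) *\<^sub>R f z - D) \<le> e"
      using fz y \<alpha> by (intro near) (auto simp: blinfun.scaleR_left)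
    moreover have "f z - 2 *\<^sub>R D = 2 *\<^sub>R ((1/2) *\<^sub>R f z - D)"
      by (simp add: scaleR_diff_right)
    ultimately show ?thesis
      by (metis norm_scaleR abs_numeral mult_left_mono zero_le_numeral)
  qed
  \<comment> \<open>This settles the origin, where the error is 0, and weakens e to
    \<open>2 * e\<close> on \<Gamma>.\<close>
  then have e: "0 \<le> e"
    using norm_ge_zero[of "f z - 2 *\<^sub>R D"] by linarith
  have "norm (f u - D) \<le> e" if "u \<in> \<Gamma>"
  proof (rule near)
    show "norm (f u) \<le> 1"
      using lip[of u orig] that pts f0 by (auto simp: Gamma_dist_def doubleton_eq_iff split: if_splits)
    have "norm (f z - f u) \<le> 1"
      using lip[of z u] that pts by (auto simp: Gamma_dist_def doubleton_eq_iff split: if_splits)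
    moreover have "blinfun_apply (f z - f u) y \<le> norm (f z - f u)"
      using norm_blinfun[of "f z - f u" y] y by simp
    ultimately show "norm y - \<alpha> < blinfun_apply (f u) y"
      using fz y by (simp add: blinfun.diff_left)
  qed
  with z e f0 u pts show ?thesis by auto
qed

text \<open>Two members of the slice are each within \<open>2 * e\<close> of a common function, so
  pointwise within \<open>4 * e\<close> of each other. Comparing two points doubles this to
  \<open>8 * e\<close>.\<close>

lemma Gamma_slice_diameter_le:
  fixes D :: "'x::real_normed_vector \<Rightarrow>\<^sub>L real"
  assumes pts: "orig \<notin> \<Gamma>" "z \<notin> \<Gamma>" "orig \<noteq> z" and y: "norm y = 1" and \<alpha>: "0 < \<alpha>" and e: "0 \<le> e"
    and near: "\<And>p :: 'x \<Rightarrow>\<^sub>L real. norm p \<le> 1 \<Longrightarrow> norm y - \<alpha> < blinfun_apply p y \<Longrightarrow> norm (p - D) \<le> e"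
  shows "Lip_diameter (Gamma_space \<Gamma> orig z) (Gamma_slice \<Gamma> orig z y \<alpha>) \<le> 8 * e"
proof (rule Lip_diameter_leI)
  fix f g
  assume fg: "f \<in> Gamma_slice \<Gamma> orig z y \<alpha>" "g \<in> Gamma_slice \<Gamma> orig z y \<alpha>"
  define k where "k u = (if u = orig then 0 else if u = z then 2 *\<^sub>R D else D)" for u
  have near_k: "norm (f u - k u) \<le> 2 * e" "norm (g u - k u) \<le> 2 * e"
    if "u \<in> \<Gamma> \<union> {orig} \<union> {z}" for u
    using Gamma_slice_near[OF _ pts y \<alpha> near that] fg by (auto simp: k_def)
  have close: "norm (f u - g u) \<le> 4 * e" if "u \<in> \<Gamma> \<union> {orig} \<union> {z}" for u
    using near_k[OF that] norm_triangle_ineq4[of "f u - k u" "g u - k u"] by simp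
  show "Lip_norm (Gamma_space \<Gamma> orig z) (\<lambda>u. f u - g u) \<le> 8 * e"
  proof (rule Lip_norm_leI[of z _ orig])
    fix u v
    assume uv: "u \<in> mspace (Gamma_space \<Gamma> orig z)" "v \<in> mspace (Gamma_space \<Gamma> orig z)" "u \<noteq> v"
    have "norm (f u - g u - (f v - g v)) \<le> 4 * e + 4 * e"
      using uv close[of u] close[of v] norm_triangle_ineq4[of "f u - g u" "f v - g v"] by simp
    \<comment> \<open>Distinct points are at distance 1 or 2, so dividing by the distance cannot
      enlarge the bound.\<close>
    also have "\<dots> \<le> 8 * e * mdist (Gamma_space \<Gamma> orig z) u v"
      using e uv(3) by (simp add: Gamma_dist_def)
    finally show "norm (f u - g u - (f v - g v)) \<le> 8 * e * mdist (Gamma_space \<Gamma> orig z) u v" .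
  qed (use pts in auto)
qed (use e in simp)

theorem proposition2p5:
  fixes \<Gamma> :: "'a set" and orig z :: 'a and y :: "'x::banach"
  assumes "infinite \<Gamma>" and "orig \<notin> \<Gamma>" and "z \<notin> \<Gamma>" and "orig \<noteq> z"
    and "norm y = 1"
    and "frechet_differentiability_point y"
  shows "(INF \<alpha>\<in>{0<..}.
            Lip_diameter (Gamma_space \<Gamma> orig z) (Gamma_slice \<Gamma> orig z y \<alpha>)) = 0"
proof (rule antisym)
  let ?d = "\<lambda>\<alpha>. Lip_diameter (Gamma_space \<Gamma> orig z) (Gamma_slice \<Gamma> orig z y \<alpha>)"
  have nonneg: "0 \<le> ?d \<alpha>" for \<alpha>
    by (rule Lip_diameter_nonneg[where u = z and v = orig and orig = orig]) (use assms(4) in \<open>auto simp: Gamma_slice_def\<close>)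
  show "0 \<le> (INF \<alpha>\<in>{0<..}. ?d \<alpha>)"
    by (rule cINF_greatest) (auto intro: nonneg)
  obtain D :: "'x \<Rightarrow>\<^sub>L real" where D:
    "\<And>e. 0 < e \<Longrightarrow> \<exists>\<alpha>>0. \<forall>p :: 'x \<Rightarrow>\<^sub>L real. norm p \<le> 1 \<longrightarrow> norm y - \<alpha> < blinfun_apply p y \<longrightarrow> norm (p - D) \<le> e"
    using frechet_smulian[OF assms(6)] by blast
  show "(INF \<alpha>\<in>{0<..}. ?d \<alpha>) \<le> 0"
  proof (rule field_le_epsilon)
    fix e :: real assume e: "0 < e"
    then obtain \<alpha> where \<alpha>: "0 < \<alpha>"
      "\<And>p :: 'x \<Rightarrow>\<^sub>L real. norm p \<le> 1 \<Longrightarrow> norm y - \<alpha> < blinfun_apply p y \<Longrightarrow> norm (p - D) \<le> e / 8"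
      using D[of "e / 8"] by auto
    \<comment> \<open>The infimum lies below its members because the diameters are bounded below by
      0.\<close>
    have "(INF \<alpha>\<in>{0<..}. ?d \<alpha>) \<le> ?d \<alpha>"
      by (rule cINF_lower) (auto intro: bdd_belowI[of _ 0] nonneg \<alpha>(1))
    also have "\<dots> \<le> 8 * (e / 8)"
      by (rule Gamma_slice_diameter_le[OF assms(2-5) \<alpha>(1) _ \<alpha>(2)]) (use e in auto)
    finally show "(INF \<alpha>\<in>{0<..}. ?d \<alpha>) \<le> 0 + e"
      by simp
  qed
qed

end
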